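(* Let $(\mathcal{F},\mathcal{O})$ be a quantum resource theory with a tensor-product structure, let $\Omega\in\mathcal{O}(A\to B)$ be a resource-reducing channel, let $N\ge1$, and let $A_1,\dots,A_N$, $B_1,\dots,B_N$ be copies of $A$, $B$ with $\mathcal{F}(A_1\dots A_N)\ne\mathcal{D}(A_1\dots A_N)$. Let $C_1,\dots,C_M$ be independent (uncensored) parties whose joint Hilbert space is identified with that of $B_1\dots B_N$, and let $\Phi_{\mathrm{S}}$ be the swap channel, $\Phi_{\mathrm{S}}(\rho\otimes\omega)=\omega\otimes\rho$, exchanging the state of $B_1\dots B_N$ with the state of $C_1\dots C_M$. If $\Phi_{\mathrm{S}}\in\mathcal{O}(B_1\dots B_NC_1\dots C_M)$ is a free operation, then censorship is breakable by account sharing, i.e. there exists a state $\rho\notin\mathcal{F}(A_1\dots A_N)$ such that $\Omega^{\otimes N}(\rho)\rightarrow_{\mathrm{c}}\rho$.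
   Context: All Hilbert spaces are finite-dimensional. $\mathcal{D}(A)$ is the set of density operators on $\mathcal{H}_A$; a quantum channel is a linear completely positive trace-preserving map. A quantum resource theory (QRT) $(\mathcal{F},\mathcal{O})$ assigns to each system $A$ a set of free states $\mathcal{F}(A)\subseteq\mathcal{D}(A)$ and to each pair of systems a set of free operations $\mathcal{O}(A\to B)$, consisting of quantum channels $\Lambda$ with $\Lambda(\sigma)\in\mathcal{F}(B)$ for all $\sigma\in\mathcal{F}(A)$. The free operations contain the identity, are closed under composition, and contain the preparation $\Lambda(\rho)=\mathrm{Tr}(\rho)\sigma$ of every free state $\sigma$. Write $\mathcal{O}(B)=\mathcal{O}(B\to B)$. Tensor-product structure: tensor products of free states are free; partial traces of free states are free; tensor products of free operations are free operations. $\omega\to\rho$ means there is a free operation $\Lambda$ with $\Lambda(\omega)=\rho$; otherwise $\omega\nrightarrow\rho$. Resource-reducing channel: a free operation $\Omega\in\mathcal{O}(A\to B)$, where $\mathcal{H}_A$ and $\mathcal{H}_B$ have the same dimension and are identified (with the same free states and operations), such that (i) $\Omega(\rho)\nrightarrow\rho$ for all $\rho\notin\mathcal{F}(A)$, and (ii) $\Omega(\sigma)=\sigma$ for all $\sigma\in\mathcal{F}(A)$. Catalytic convertibility with independents $C_1,\dots,C_M$: for states $\gamma,\rho$ of $B_1\dots B_N$, $\gamma\rightarrow_{\mathrm{c}}\rho$ means there exist a state $\omega_C\in\mathcal{D}(C_1\dots C_M)$ and a free operation $\Lambda\in\mathcal{O}(B_1\dots B_NC_1\dots C_M)$ with $\mathrm{Tr}_{C_1\dots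 C_M}\{\Lambda(\gamma\otimes\omega_C)\}=\rho$. The catalyst $\omega_C$ need not be free and need not be returned. Censorship is secure against account sharing if $\Omega^{\otimes N}(\rho)\nrightarrow_{\mathrm{c}}\rho$ for all $\rho\notin\mathcal{F}(A_1\dots A_N)$, and breakable by account sharing otherwise. *)

theory Defs
  imports "Jordan_Normal_Form.Matrix" "HOL-Library.FuncSet"
begin

section \<open>States and channels on finite-dimensional Hilbert spaces\<close>

text \<open>An \<open>n\<close>-dimensional Hilbert space is \<open>\<complex>\<^sup>n\<close>, and its operators are \<open>carrier_mat n n\<close>.
  The order on \<open>complex\<close> is the one of \<^theory>\<open>HOL-Library.Complex_Order\<close>: \<open>0 \<le> z\<close> says that \<open>z\<close> is
  real and nonnegative, so a matrix satisfying \<open>psd\<close> is in particular Hermitian.\<close>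

definition psd :: "nat \<Rightarrow> complex mat \<Rightarrow> bool" where
  "psd n A \<longleftrightarrow> A \<in> carrier_mat n n \<and> (\<forall>v \<in> carrier_vec n. 0 \<le> (A *\<^sub>v v) \<bullet>c v)"

definition trace :: "complex mat \<Rightarrow> complex" where
  "trace A = (\<Sum>i<dim_row A. A $$ (i, i))"

definition density_ops :: "nat \<Rightarrow> complex mat set" where
  "density_ops n = {\<rho>. psd n \<rho> \<and> trace \<rho> = 1}"

text \<open>Kronecker product: the basis vector \<open>e\<^sub>i \<otimes> e\<^sub>k\<close> of \<open>\<complex>\<^sup>a \<otimes> \<complex>\<^sup>c\<close> has index \<open>i * c + k\<close>. With this
  convention the product is strictly associative.\<close>

definition kron :: "complex mat \<Rightarrow> complex mat \<Rightarrow> complex mat" where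
  "kron A B = mat (dim_row A * dim_row B) (dim_col A * dim_col B)
     (\<lambda>(r, s). A $$ (r div dim_row B, s div dim_col B) * B $$ (r mod dim_row B, s mod dim_col B))"

text \<open>\<open>partial_trace a b c\<close> traces out the middle factor of \<open>\<complex>\<^sup>a \<otimes> \<complex>\<^sup>b \<otimes> \<complex>\<^sup>c\<close>. Taking \<open>c = 1\<close> or \<open>a = 1\<close>
  gives the partial trace over the last or the first factor.\<close>

definition partial_trace :: "nat \<Rightarrow> nat \<Rightarrow> nat \<Rightarrow> complex mat \<Rightarrow> complex mat" where
  "partial_trace a b c X = mat (a * c) (a * c)
     (\<lambda>(r, s). \<Sum>k<b. X $$ ((r div c * b + k) * c + r mod c, (s div c * b + k) * c + s mod c))"

text \<open>Maps between operator spaces are extensional (\<open>undefined\<close> off their domain), so that equality of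
  HOL functions is equality of maps.\<close>

definition linear_maps :: "nat \<Rightarrow> nat \<Rightarrow> (complex mat \<Rightarrow> complex mat) set" where
  "linear_maps a b = {\<Lambda> \<in> carrier_mat a a \<rightarrow>\<^sub>E carrier_mat b b.
     (\<forall>X \<in> carrier_mat a a. \<forall>Y \<in> carrier_mat a a. \<Lambda> (X + Y) = \<Lambda> X + \<Lambda> Y) \<and>
     (\<forall>c. \<forall>X \<in> carrier_mat a a. \<Lambda> (c \<cdot>\<^sub>m X) = c \<cdot>\<^sub>m \<Lambda> X)}"

definition id_map :: "nat \<Rightarrow> complex mat \<Rightarrow> complex mat" where
  "id_map n = (\<lambda>X \<in> carrier_mat n n. X)"

definition elem_mat :: "nat \<Rightarrow> nat \<Rightarrow> nat \<Rightarrow> complex mat" where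
  "elem_mat n i j = mat n n (\<lambda>(r, s). if r = i \<and> s = j then 1 else 0)"

text \<open>For \<open>\<Lambda> \<in> linear_maps a b\<close> and \<open>\<Gamma> \<in> linear_maps c d\<close>, the map \<open>\<Lambda> \<otimes> \<Gamma>\<close> is defined by expanding its
  argument in the basis \<open>E\<^sub>i\<^sub>j \<otimes> E\<^sub>k\<^sub>l\<close>; see \<open>tensor_map_kron\<close> below.\<close>

definition tensor_map :: "nat \<Rightarrow> nat \<Rightarrow> nat \<Rightarrow> nat \<Rightarrow> (complex mat \<Rightarrow> complex mat) \<Rightarrow>
    (complex mat \<Rightarrow> complex mat) \<Rightarrow> complex mat \<Rightarrow> complex mat" where
  "tensor_map a b c d \<Lambda> \<Gamma> = (\<lambda>X \<in> carrier_mat (a * c) (a * c).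
     mat (b * d) (b * d) (\<lambda>rs. \<Sum>i<a. \<Sum>j<a. \<Sum>k<c. \<Sum>l<c.
       X $$ (i * c + k, j * c + l) * kron (\<Lambda> (elem_mat a i j)) (\<Gamma> (elem_mat c k l)) $$ rs))"

fun tensor_power :: "nat \<Rightarrow> nat \<Rightarrow> (complex mat \<Rightarrow> complex mat) \<Rightarrow> nat \<Rightarrow> complex mat \<Rightarrow> complex mat" where
  "tensor_power a b \<Lambda> 0 = id_map 1"
| "tensor_power a b \<Lambda> (Suc 0) = \<Lambda>"
| "tensor_power a b \<Lambda> (Suc (Suc n)) =
     tensor_map a b (a ^ Suc n) (b ^ Suc n) \<Lambda> (tensor_power a b \<Lambda> (Suc n))"

definition completely_positive :: "nat \<Rightarrow> nat \<Rightarrow> (complex mat \<Rightarrow> complex mat) \<Rightarrow> bool" where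
  "completely_positive a b \<Lambda> \<longleftrightarrow>
     (\<forall>k X. psd (k * a) X \<longrightarrow> psd (k * b) (tensor_map k k a b (id_map k) \<Lambda> X))"

definition trace_preserving :: "nat \<Rightarrow> (complex mat \<Rightarrow> complex mat) \<Rightarrow> bool" where
  "trace_preserving a \<Lambda> \<longleftrightarrow> (\<forall>X \<in> carrier_mat a a. trace (\<Lambda> X) = trace X)"

definition channels :: "nat \<Rightarrow> nat \<Rightarrow> (complex mat \<Rightarrow> complex mat) set" where
  "channels a b = {\<Lambda> \<in> linear_maps a b. completely_positive a b \<Lambda> \<and> trace_preserving a \<Lambda>}"

definition prep_map :: "nat \<Rightarrow> complex mat \<Rightarrow> complex mat \<Rightarrow> complex mat" where
  "prep_map a \<sigma> = (\<lambda>X \<in> carrier_mat a a. trace X \<cdot>\<^sub>m \<sigma>)"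

text \<open>Conjugation by the unitary \<open>e\<^sub>i \<otimes> e\<^sub>j \<mapsto> e\<^sub>j \<otimes> e\<^sub>i\<close> of \<open>\<complex>\<^sup>d \<otimes> \<complex>\<^sup>d\<close>, written out on entries.\<close>

definition swap_map :: "nat \<Rightarrow> complex mat \<Rightarrow> complex mat" where
  "swap_map d = (\<lambda>X \<in> carrier_mat (d * d) (d * d).
     mat (d * d) (d * d) (\<lambda>(r, s). X $$ (r mod d * d + r div d, s mod d * d + s div d)))"


section \<open>Quantum resource theories\<close>

text \<open>A system is a nonempty list of elementary subsystems with labels in \<open>'s\<close>; composition of systems
  is \<open>@\<close>. The free states and operations of a system may depend on how it is composed, not only on
  its dimension. The values of \<open>free_states\<close> and \<open>free_ops\<close> at the empty list carry no meaning.\<close>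

record 's qrt =
  elem_dim :: "'s \<Rightarrow> nat"
  free_states :: "'s list \<Rightarrow> complex mat set"
  free_ops :: "'s list \<Rightarrow> 's list \<Rightarrow> (complex mat \<Rightarrow> complex mat) set"

definition hdim :: "'s qrt \<Rightarrow> 's list \<Rightarrow> nat" where
  "hdim T A = prod_list (map (elem_dim T) A)"

abbreviation states :: "'s qrt \<Rightarrow> 's list \<Rightarrow> complex mat set" where
  "states T A \<equiv> density_ops (hdim T A)"

locale quantum_resource_theory =
  fixes T :: "'s qrt"
  assumes elem_dim_pos: "elem_dim T s > 0"
    and free_states_sub: "A \<noteq> [] \<Longrightarrow> free_states T A \<subseteq> states T A"
    and free_ops_sub: "\<lbrakk>A \<noteq> []; B \<noteq> []\<rbrakk> \<Longrightarrow> free_ops T A B \<subseteq> channels (hdim T A) (hdim T B)"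
    and free_ops_preserve:
      "\<lbrakk>A \<noteq> []; B \<noteq> []; \<Lambda> \<in> free_ops T A B; \<sigma> \<in> free_states T A\<rbrakk> \<Longrightarrow> \<Lambda> \<sigma> \<in> free_states T B"
    and free_ops_id: "A \<noteq> [] \<Longrightarrow> id_map (hdim T A) \<in> free_ops T A A"
    and free_ops_comp:
      "\<lbrakk>A \<noteq> []; B \<noteq> []; C \<noteq> []; \<Lambda> \<in> free_ops T A B; \<Gamma> \<in> free_ops T B C\<rbrakk> \<Longrightarrow>
         compose (carrier_mat (hdim T A) (hdim T A)) \<Gamma> \<Lambda> \<in> free_ops T A C"
    and free_ops_prep:
      "\<lbrakk>A \<noteq> []; B \<noteq> []; \<sigma> \<in> free_states T B\<rbrakk> \<Longrightarrow> prep_map (hdim T A) \<sigma> \<in> free_ops T A B"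

text \<open>In \<open>free_states_partial_trace\<close>, \<open>A\<close> or \<open>C\<close> may be empty. Iterating it gives the partial trace over
  any proper subset of the subsystems.\<close>

locale tensor_quantum_resource_theory = quantum_resource_theory +
  assumes free_states_tensor:
      "\<lbrakk>A \<noteq> []; B \<noteq> []; \<rho> \<in> free_states T A; \<sigma> \<in> free_states T B\<rbrakk> \<Longrightarrow>
         kron \<rho> \<sigma> \<in> free_states T (A @ B)"
    and free_states_partial_trace:
      "\<lbrakk>B \<noteq> []; A @ C \<noteq> []; \<rho> \<in> free_states T (A @ B @ C)\<rbrakk> \<Longrightarrow>
         partial_trace (hdim T A) (hdim T B) (hdim T C) \<rho> \<in> free_states T (A @ C)"
    and free_ops_tensor:
      "\<lbrakk>A \<noteq> []; B \<noteq> []; C \<noteq> []; D \<noteq> []; \<Lambda> \<in> free_ops T A B; \<Gamma> \<in> free_ops T C D\<rbrakk> \<Longrightarrow>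
         tensor_map (hdim T A) (hdim T B) (hdim T C) (hdim T D) \<Lambda> \<Gamma> \<in> free_ops T (A @ C) (B @ D)"

definition convertible :: "'s qrt \<Rightarrow> 's list \<Rightarrow> 's list \<Rightarrow> complex mat \<Rightarrow> complex mat \<Rightarrow> bool" where
  "convertible T A B \<omega> \<rho> \<longleftrightarrow> (\<exists>\<Lambda> \<in> free_ops T A B. \<Lambda> \<omega> = \<rho>)"

definition identified :: "'s qrt \<Rightarrow> 's list \<Rightarrow> 's list \<Rightarrow> bool" where
  "identified T A B \<longleftrightarrow> hdim T A = hdim T B \<and> free_states T A = free_states T B \<and>
     (\<forall>X. X \<noteq> [] \<longrightarrow> free_ops T A X = free_ops T B X \<and> free_ops T X A = free_ops T X B)"

definition copies :: "'s qrt \<Rightarrow> nat \<Rightarrow> 's list \<Rightarrow> 's list list \<Rightarrow> bool" where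
  "copies T N A As \<longleftrightarrow> length As = N \<and> (\<forall>X \<in> set As. X \<noteq> [] \<and> identified T A X)"

definition resource_reducing ::
    "'s qrt \<Rightarrow> 's list \<Rightarrow> 's list \<Rightarrow> (complex mat \<Rightarrow> complex mat) \<Rightarrow> bool" where
  "resource_reducing T A B \<Omega> \<longleftrightarrow> \<Omega> \<in> free_ops T A B \<and> identified T A B \<and>
     (\<forall>\<rho> \<in> states T A - free_states T A. \<not> convertible T B A (\<Omega> \<rho>) \<rho>) \<and>
     (\<forall>\<sigma> \<in> free_states T A. \<Omega> \<sigma> = \<sigma>)"

text \<open>\<open>Bs\<close> and \<open>Cs\<close> list the parties; \<open>concat Bs\<close> and \<open>concat Cs\<close> are the joint systems.\<close>

definition catalytically_convertible ::
    "'s qrt \<Rightarrow> 's list list \<Rightarrow> 's list list \<Rightarrow> complex mat \<Rightarrow> complex mat \<Rightarrow> bool" where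
  "catalytically_convertible T Bs Cs \<gamma> \<rho> \<longleftrightarrow>
     (\<exists>\<omega> \<in> states T (concat Cs).
      \<exists>\<Lambda> \<in> free_ops T (concat Bs @ concat Cs) (concat Bs @ concat Cs).
        partial_trace (hdim T (concat Bs)) (hdim T (concat Cs)) 1 (\<Lambda> (kron \<gamma> \<omega>)) = \<rho>)"

definition secure_against_account_sharing :: "'s qrt \<Rightarrow> 's list \<Rightarrow> 's list \<Rightarrow>
    (complex mat \<Rightarrow> complex mat) \<Rightarrow> nat \<Rightarrow> 's list list \<Rightarrow> 's list list \<Rightarrow> 's list list \<Rightarrow> bool" where
  "secure_against_account_sharing T A B \<Omega> N As Bs Cs \<longleftrightarrow>
     (\<forall>\<rho> \<in> states T (concat As) - free_states T (concat As).
        \<not> catalytically_convertible T Bs Cs (tensor_power (hdim T A) (hdim T B) \<Omega> N \<rho>) \<rho>)"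

definition breakable_by_account_sharing :: "'s qrt \<Rightarrow> 's list \<Rightarrow> 's list \<Rightarrow>
    (complex mat \<Rightarrow> complex mat) \<Rightarrow> nat \<Rightarrow> 's list list \<Rightarrow> 's list list \<Rightarrow> 's list list \<Rightarrow> bool" where
  "breakable_by_account_sharing T A B \<Omega> N As Bs Cs \<longleftrightarrow>
     \<not> secure_against_account_sharing T A B \<Omega> N As Bs Cs"

lemma breakable_by_account_sharing_iff:
  "breakable_by_account_sharing T A B \<Omega> N As Bs Cs \<longleftrightarrow>
     (\<exists>\<rho> \<in> states T (concat As) - free_states T (concat As).
        catalytically_convertible T Bs Cs (tensor_power (hdim T A) (hdim T B) \<Omega> N \<rho>) \<rho>)"
  by (simp add: breakable_by_account_sharing_def secure_against_account_sharing_def)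


section \<open>The matrix formulas on product operators\<close>

lemma pair_index_less: "i < a \<Longrightarrow> k < b \<Longrightarrow> i * b + k < a * (b::nat)"
proof -
  assume "i < a" "k < b"
  then have "i * b + k < Suc i * b" by simp
  also have "\<dots> \<le> a * b" using \<open>i < a\<close> by (intro mult_le_mono1) simp
  finally show ?thesis .
qed

lemma div_mod_less:
  assumes "r < a * (d::nat)" shows "r div d < a" "r mod d < d"
proof -
  have "d > 0" using assms by (cases d) auto
  then show "r div d < a" "r mod d < d" using assms by (simp_all add: less_mult_imp_div_less)
qed

lemma kron_index:
  assumes "X \<in> carrier_mat a a" "Y \<in> carrier_mat b b" "i < a" "j < a" "k < b" "l < b"
  shows "kron X Y $$ (i * b + k, j * b + l) = X $$ (i, j) * Y $$ (k, l)"
  using assms by (simp add: kron_def pair_index_less)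

lemma kron_carrier [simp]:
  "X \<in> carrier_mat a a \<Longrightarrow> Y \<in> carrier_mat b b \<Longrightarrow> kron X Y \<in> carrier_mat (a * b) (a * b)"
  by (simp add: kron_def)

lemma elem_mat_carrier [simp]: "elem_mat n i j \<in> carrier_mat n n"
  by (simp add: elem_mat_def)

lemma linear_maps_expand:
  assumes L: "\<Lambda> \<in> linear_maps a b" and X: "X \<in> carrier_mat a a" and rs: "r < b" "s < b"
  shows "\<Lambda> X $$ (r, s) = (\<Sum>i<a. \<Sum>j<a. X $$ (i, j) * \<Lambda> (elem_mat a i j) $$ (r, s))"
proof -
  have car: "\<Lambda> Y \<in> carrier_mat b b" if "Y \<in> carrier_mat a a" for Y
    using L that by (auto simp: linear_maps_def)
  have add: "\<Lambda> (Y + Z) = \<Lambda> Y + \<Lambda> Z" if "Y \<in> carrier_mat a a" "Z \<in> carrier_mat a a" for Y Z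
    using L that by (auto simp: linear_maps_def)
  have smult: "\<Lambda> (c \<cdot>\<^sub>m Y) = c \<cdot>\<^sub>m \<Lambda> Y" if "Y \<in> carrier_mat a a" for c Y
    using L that by (auto simp: linear_maps_def)
  define R where "R S = mat a a (\<lambda>p. if p \<in> S then X $$ p else 0)" for S
  have "\<Lambda> (R S) $$ (r, s) = (\<Sum>(i, j)\<in>S. X $$ (i, j) * \<Lambda> (elem_mat a i j) $$ (r, s))"
    if "finite S" "S \<subseteq> {..<a} \<times> {..<a}" for S
    using that
  proof (induction S rule: finite_induct)
    case empty
    have "R {} = 0 \<cdot>\<^sub>m R {}" by (rule eq_matI) (auto simp: R_def)
    then have "\<Lambda> (R {}) = 0 \<cdot>\<^sub>m \<Lambda> (R {})" using smult[of "R {}" 0] by (simp add: R_def)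
    moreover have "\<Lambda> (R {}) \<in> carrier_mat b b" by (rule car) (simp add: R_def)
    ultimately have "\<Lambda> (R {}) $$ (r, s) = 0 * \<Lambda> (R {}) $$ (r, s)"
      using rs by (metis carrier_matD index_smult_mat(1))
    then show ?case by simp
  next
    case (insert p S)
    obtain i j where p: "p = (i, j)" by (cases p)
    have ij: "i < a" "j < a" using insert.prems p by auto
    have "R (insert p S) = X $$ (i, j) \<cdot>\<^sub>m elem_mat a i j + R S"
      using insert.hyps p by (intro eq_matI) (auto simp: R_def elem_mat_def)
    moreover have "R S \<in> carrier_mat a a" by (simp add: R_def)
    ultimately have "\<Lambda> (R (insert p S)) = X $$ (i, j) \<cdot>\<^sub>m \<Lambda> (elem_mat a i j) + \<Lambda> (R S)"
      using add smult by simp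
    moreover have "\<Lambda> (R S) \<in> carrier_mat b b" "\<Lambda> (elem_mat a i j) \<in> carrier_mat b b"
      by (rule car; simp add: R_def)+
    ultimately have "\<Lambda> (R (insert p S)) $$ (r, s)
        = X $$ (i, j) * \<Lambda> (elem_mat a i j) $$ (r, s) + \<Lambda> (R S) $$ (r, s)"
      using rs by simp
    then show ?case using insert p by simp
  qed
  from this[of "{..<a} \<times> {..<a}"] have "\<Lambda> (R ({..<a} \<times> {..<a})) $$ (r, s)
      = (\<Sum>i<a. \<Sum>j<a. X $$ (i, j) * \<Lambda> (elem_mat a i j) $$ (r, s))"
    by (simp add: sum.cartesian_product)
  moreover have "R ({..<a} \<times> {..<a}) = X"
    using X by (intro eq_matI) (auto simp: R_def)
  ultimately show ?thesis by simp
qed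

lemma tensor_map_kron:
  assumes L: "\<Lambda> \<in> linear_maps a b" and G: "\<Gamma> \<in> linear_maps c d"
    and X: "X \<in> carrier_mat a a" and Y: "Y \<in> carrier_mat c c"
  shows "tensor_map a b c d \<Lambda> \<Gamma> (kron X Y) = kron (\<Lambda> X) (\<Gamma> Y)"
proof -
  have LX: "\<Lambda> Z \<in> carrier_mat b b" if "Z \<in> carrier_mat a a" for Z
    using L that by (auto simp: linear_maps_def)
  have GY: "\<Gamma> Z \<in> carrier_mat d d" if "Z \<in> carrier_mat c c" for Z
    using G that by (auto simp: linear_maps_def)
  have [simp]: "dim_row (\<Lambda> X) = b" "dim_col (\<Lambda> X) = b" "dim_row (\<Gamma> Y) = d" "dim_col (\<Gamma> Y) = d"
    "dim_row (\<Lambda> (elem_mat a i j)) = b" "dim_col (\<Lambda> (elem_mat a i j)) = b"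
    "dim_row (\<Gamma> (elem_mat c i j)) = d" "dim_col (\<Gamma> (elem_mat c i j)) = d" for i j
    using LX[OF X] GY[OF Y] LX[OF elem_mat_carrier] GY[OF elem_mat_carrier] by auto
  show ?thesis
  proof (rule eq_matI)
    fix r s assume "r < dim_row (kron (\<Lambda> X) (\<Gamma> Y))" "s < dim_col (kron (\<Lambda> X) (\<Gamma> Y))"
    then have rs: "r < b * d" "s < b * d" by (simp_all add: kron_def)
    note lt = div_mod_less[OF rs(1)] div_mod_less[OF rs(2)]
    let ?l = "\<lambda>i j. \<Lambda> (elem_mat a i j) $$ (r div d, s div d)"
    let ?g = "\<lambda>k l. \<Gamma> (elem_mat c k l) $$ (r mod d, s mod d)"
    have "tensor_map a b c d \<Lambda> \<Gamma> (kron X Y) $$ (r, s)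
        = (\<Sum>i<a. \<Sum>j<a. \<Sum>k<c. \<Sum>l<c. (X $$ (i, j) * Y $$ (k, l)) * (?l i j * ?g k l))"
      using rs X Y by (simp add: tensor_map_def kron_index) (simp add: kron_def)
    also have "\<dots> = (\<Sum>i<a. \<Sum>j<a. X $$ (i, j) * ?l i j) * (\<Sum>k<c. \<Sum>l<c. Y $$ (k, l) * ?g k l)"
      by (simp only: sum_distrib_right) (simp only: sum_distrib_left mult_ac)
    also have "\<dots> = \<Lambda> X $$ (r div d, s div d) * \<Gamma> Y $$ (r mod d, s mod d)"
      using linear_maps_expand[OF L X] linear_maps_expand[OF G Y] lt by simp
    also have "\<dots> = kron (\<Lambda> X) (\<Gamma> Y) $$ (r, s)"
      using rs by (simp add: kron_def)
    finally show "tensor_map a b c d \<Lambda> \<Gamma> (kron X Y) $$ (r, s) = kron (\<Lambda> X) (\<Gamma> Y) $$ (r, s)" .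
  qed (use X Y in \<open>auto simp: tensor_map_def kron_def\<close>)
qed

lemma swap_map_kron:
  assumes X: "X \<in> carrier_mat d d" and Y: "Y \<in> carrier_mat d d"
  shows "swap_map d (kron X Y) = kron Y X"
proof (rule eq_matI)
  fix r s assume "r < dim_row (kron Y X)" "s < dim_col (kron Y X)"
  then have rs: "r < d * d" "s < d * d" using X Y by (simp_all add: kron_def)
  note lt = div_mod_less[OF rs(1)] div_mod_less[OF rs(2)]
  have "kron X Y $$ (r mod d * d + r div d, s mod d * d + s div d)
      = X $$ (r mod d, s mod d) * Y $$ (r div d, s div d)"
    using kron_index[OF X Y] lt by simp
  then show "swap_map d (kron X Y) $$ (r, s) = kron Y X $$ (r, s)"
    using rs X Y by (simp add: swap_map_def kron_def mult.commute)
qed (use X Y in \<open>auto simp: swap_map_def kron_def\<close>)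

lemma partial_trace_kron:
  assumes X: "X \<in> carrier_mat a a" and Y: "Y \<in> carrier_mat b b" and Z: "Z \<in> carrier_mat c c"
  shows "partial_trace a b c (kron (kron X Y) Z) = trace Y \<cdot>\<^sub>m kron X Z"
proof (rule eq_matI)
  fix r s assume "r < dim_row (trace Y \<cdot>\<^sub>m kron X Z)" "s < dim_col (trace Y \<cdot>\<^sub>m kron X Z)"
  then have rs: "r < a * c" "s < a * c" using X Z by (simp_all add: kron_def)
  note lt = div_mod_less[OF rs(1)] div_mod_less[OF rs(2)]
  have "kron (kron X Y) Z $$ ((r div c * b + k) * c + r mod c, (s div c * b + k) * c + s mod c)
      = X $$ (r div c, s div c) * Y $$ (k, k) * Z $$ (r mod c, s mod c)" if "k < b" for k
    using kron_index[OF kron_carrier[OF X Y] Z pair_index_less pair_index_less]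
      kron_index[OF X Y] lt that by simp
  then show "partial_trace a b c (kron (kron X Y) Z) $$ (r, s) = (trace Y \<cdot>\<^sub>m kron X Z) $$ (r, s)"
    using rs X Y Z
    by (simp add: partial_trace_def kron_def trace_def sum_distrib_left sum_distrib_right mult_ac)
qed (use X Z in \<open>auto simp: partial_trace_def kron_def\<close>)

end

theory Submission
  imports Defs
begin

text \<open>The cheating parties feed \<open>\<rho>\<close> itself in as the catalyst, and the swap delivers it to \<open>B\<^sub>1 \<dots> B\<^sub>N\<close>.
  Tracing out the other half then removes the censored state, of which only the trace matters: it is
  \<open>1\<close> because \<open>\<Omega>\<close> preserves traces, hence so does its tensor power.\<close>

text \<open>The range below \<open>a * c\<close> splits into \<open>a\<close> blocks of length
  \<open>c\<close>. This matches the index convention of \<open>kron\<close>, so a trace on a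
  product space becomes a double sum over its factors.\<close>

lemma sum_pair_index:
  fixes f :: "nat \<Rightarrow> 'a :: comm_monoid_add"
  shows "(\<Sum>r<a * c. f r) = (\<Sum>i<a. \<Sum>k<c. f (i * c + k))"
proof -
  have "sum f {i * c..<i * c + c} = (\<Sum>k<c. f (i * c + k))" for i
    using sum.shift_bounds_nat_ivl[of f 0 "i * c" c]
    by (simp add: atLeast0LessThan add.commute)
  then show ?thesis by (simp flip: sum.nat_group)
qed

lemma trace_kron:
  assumes "X \<in> carrier_mat b b" "Y \<in> carrier_mat d d"
  shows "trace (kron X Y) = trace X * trace Y"
  using assms carrier_matD(1)[OF kron_carrier[OF assms]]
  by (simp add: trace_def sum_pair_index sum_product kron_index[OF assms])

lemma trace_elem_mat: "i < n \<Longrightarrow> trace (elem_mat n i j) = (if i = j then 1 else 0)"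
  by (auto simp: trace_def elem_mat_def if_distrib intro!: sum.neutral)

text \<open>Lets the last of the three factors in \<open>partial_trace_kron\<close> be the trivial
  space of dimension \<open>1\<close>.\<close>

lemma kron_one_mat_1: "X \<in> carrier_mat n n \<Longrightarrow> kron X (1\<^sub>m 1) = X"
  by (intro eq_matI) (auto simp: kron_def)

text \<open>\<open>tensor_map\<close> expands any operator, product or not, over pairs of matrix
  units. On each pair the trace factorises, and both factors are known from trace preservation, so
  only diagonal entries survive.\<close>

lemma trace_preserving_tensor_map:
  assumes L: "\<Lambda> \<in> carrier_mat a a \<rightarrow> carrier_mat b b" "trace_preserving a \<Lambda>"
    and G: "\<Gamma> \<in> carrier_mat c c \<rightarrow> carrier_mat d d" "trace_preserving c \<Gamma>"
  shows "trace_preserving (a * c) (tensor_map a b c d \<Lambda> \<Gamma>)"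
  unfolding trace_preserving_def
proof
  fix X :: "complex mat" assume X: "X \<in> carrier_mat (a * c) (a * c)"
  let ?K = "\<lambda>i j k l. kron (\<Lambda> (elem_mat a i j)) (\<Gamma> (elem_mat c k l))"
  let ?x = "\<lambda>i j k l. X $$ (i * c + k, j * c + l)"
  have LE: "\<Lambda> (elem_mat a i j) \<in> carrier_mat b b" for i j using L by auto
  have GE: "\<Gamma> (elem_mat c i j) \<in> carrier_mat d d" for i j using G by auto
  have K: "(\<Sum>r<b * d. ?K i j k l $$ (r, r)) = (if i = j then 1 else 0) * (if k = l then 1 else 0)"
    if "i < a" "k < c" for i j k l
  proof -
    have "(\<Sum>r<b * d. ?K i j k l $$ (r, r)) = trace (?K i j k l)"
      using carrier_matD(1)[OF kron_carrier[OF LE GE]] by (simp add: trace_def)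
    also have "\<dots> = trace (elem_mat a i j) * trace (elem_mat c k l)"
      using L(2) G(2) by (simp add: trace_kron[OF LE GE] trace_preserving_def)
    finally show ?thesis using that by (simp add: trace_elem_mat)
  qed
  have "trace (tensor_map a b c d \<Lambda> \<Gamma> X)
      = (\<Sum>r<b * d. \<Sum>i<a. \<Sum>j<a. \<Sum>k<c. \<Sum>l<c. ?x i j k l * ?K i j k l $$ (r, r))"
    using X by (simp add: trace_def tensor_map_def)
  also have "\<dots> = (\<Sum>i<a. \<Sum>j<a. \<Sum>k<c. \<Sum>l<c. ?x i j k l * (\<Sum>r<b * d. ?K i j k l $$ (r, r)))"
    by (simp only: sum.swap[where A = "{..<b * d}"] sum_distrib_left)
  also have "\<dots> = (\<Sum>i<a. \<Sum>j<a. \<Sum>k<c. \<Sum>l<c. if l = k then (if j = i then ?x i j k l else 0) else 0)"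
    by (intro sum.cong refl) (auto simp: K)
  \<comment> \<open>The sum over \<open>l\<close> collapses to \<open>l = k\<close>; moving the sum
    over \<open>k\<close> outwards leaves the sum over \<open>j\<close> innermost, where it
    collapses to \<open>j = i\<close> in the next step.\<close>
  also have "\<dots> = (\<Sum>i<a. \<Sum>k<c. \<Sum>j<a. if j = i then ?x i j k k else 0)"
    by (simp add: sum.swap[where A = "{..<a}" and B = "{..<c}"])
  also have "\<dots> = trace X"
    using X by (simp add: trace_def sum_pair_index)
  finally show "trace (tensor_map a b c d \<Lambda> \<Gamma> X) = trace X" .
qed

lemma tensor_map_carrier:
  "tensor_map a b c d \<Lambda> \<Gamma> \<in> carrier_mat (a * c) (a * c) \<rightarrow> carrier_mat (b * d) (b * d)"
  by (auto simp: tensor_map_def)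

text \<open>The carrier claim is proved along with the trace claim because
  \<open>trace_preserving_tensor_map\<close> asks for both from the smaller power.\<close>

lemma trace_preserving_tensor_power:
  assumes "\<Lambda> \<in> carrier_mat a a \<rightarrow> carrier_mat b b" "trace_preserving a \<Lambda>"
  shows "tensor_power a b \<Lambda> N \<in> carrier_mat (a ^ N) (a ^ N) \<rightarrow> carrier_mat (b ^ N) (b ^ N)
    \<and> trace_preserving (a ^ N) (tensor_power a b \<Lambda> N)"
  using assms
proof (induction a b \<Lambda> N rule: tensor_power.induct)
  case (3 a b \<Lambda> n)
  then show ?case
    using tensor_map_carrier[of a b "a ^ Suc n" "b ^ Suc n"]
      trace_preserving_tensor_map[of \<Lambda> a b "tensor_power a b \<Lambda> (Suc n)" "a ^ Suc n" "b ^ Suc n"]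
    by simp
qed (auto simp: id_map_def trace_preserving_def)

lemma hdim_concat_copies: "copies T N A As \<Longrightarrow> hdim T (concat As) = hdim T A ^ N"
proof (induction As arbitrary: N)
  case (Cons X As)
  then have "hdim T (concat As) = hdim T A ^ length As" "hdim T X = hdim T A" "N = Suc (length As)"
    by (auto simp: copies_def identified_def)
  then show ?case by (simp add: hdim_def)
qed (simp add: copies_def hdim_def)

theorem theorem2:
  fixes T :: "'s qrt"
    and A B :: "'s list"
    and As Bs Cs :: "'s list list"
    and \<Omega> :: "complex mat \<Rightarrow> complex mat"
    and N M :: nat
  assumes "tensor_quantum_resource_theory T"
    and "A \<noteq> []" and "B \<noteq> []"
    and "resource_reducing T A B \<Omega>"
    and "N \<ge> 1"
    and "copies T N A As" and "copies T N B Bs"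
    and "free_states T (concat As) \<noteq> states T (concat As)"
    and "M \<ge> 1" and "length Cs = M" and "\<forall>C \<in> set Cs. C \<noteq> []"
    and "hdim T (concat Cs) = hdim T (concat Bs)"
    and "swap_map (hdim T (concat Bs))
           \<in> free_ops T (concat Bs @ concat Cs) (concat Bs @ concat Cs)"
  shows "breakable_by_account_sharing T A B \<Omega> N As Bs Cs"
proof -
  interpret tensor_quantum_resource_theory T by fact
  let ?a = "hdim T A" and ?b = "hdim T B"
  define d where "d = hdim T (concat Bs)"
  have \<Omega>: "\<Omega> \<in> free_ops T A B" and "?a = ?b"
    using assms(4) by (auto simp: resource_reducing_def identified_def)
  then have \<Omega>: "\<Omega> \<in> carrier_mat ?a ?a \<rightarrow> carrier_mat ?b ?b" "trace_preserving ?a \<Omega>"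
    using free_ops_sub[OF assms(2,3)] by (auto simp: channels_def linear_maps_def)
  \<comment> \<open>Since \<open>A\<close> and \<open>B\<close> have equal dimension, a state of the
    senders is also a density operator on the catalyst space.\<close>
  have dims: "hdim T (concat As) = d" "?a ^ N = d" "?b ^ N = d" "hdim T (concat Cs) = d"
    using hdim_concat_copies[OF assms(6)] hdim_concat_copies[OF assms(7)] \<open>?a = ?b\<close> assms(12)
    by (simp_all add: d_def)
  \<comment> \<open>This is where \<open>N \<ge> 1\<close> enters: \<open>free_states_sub\<close>
    says nothing about the empty system.\<close>
  have "concat As \<noteq> []"
    using assms(5,6) by (cases As) (auto simp: copies_def)
  then obtain \<rho> where \<rho>: "\<rho> \<in> states T (concat As) - free_states T (concat As)"
    using free_states_sub assms(8) by blast
  then have \<rho>d: "\<rho> \<in> density_ops d" and \<rho>car: "\<rho> \<in> carrier_mat d d" and "trace \<rho> = 1"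
    by (auto simp: dims density_ops_def psd_def)
  define \<gamma> where "\<gamma> = tensor_power ?a ?b \<Omega> N \<rho>"
  have \<gamma>: "\<gamma> \<in> carrier_mat d d" "trace \<gamma> = 1"
    using trace_preserving_tensor_power[OF \<Omega>, of N] \<rho>car \<open>trace \<rho> = 1\<close>
    by (auto simp: \<gamma>_def dims trace_preserving_def)
  \<comment> \<open>Tracing out \<open>\<gamma>\<close> leaves \<open>\<rho>\<close> scaled by the
    trace of \<open>\<gamma>\<close>, which is \<open>1\<close>.\<close>
  have "partial_trace d d 1 (kron \<rho> \<gamma>) = \<rho>"
    using partial_trace_kron[OF \<rho>car \<gamma>(1) one_carrier_mat[of 1]]
    unfolding kron_one_mat_1[OF kron_carrier[OF \<rho>car \<gamma>(1)]] kron_one_mat_1[OF \<rho>car] \<gamma>(2)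
    using \<rho>car by auto
  then have "partial_trace d d 1 (swap_map d (kron \<gamma> \<rho>)) = \<rho>"
    by (simp add: swap_map_kron[OF \<gamma>(1) \<rho>car])
  then have "catalytically_convertible T Bs Cs \<gamma> \<rho>"
    unfolding catalytically_convertible_def using \<rho>d assms(13) by (auto simp: dims simp flip: d_def)
  then show ?thesis
    using \<rho> by (auto simp: breakable_by_account_sharing_iff \<gamma>_def)
qed

end
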